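(* Let $n\ge 1$ be an integer and suppose $\frac{R\mu}{C}\ge n+1$. Then the social benefit rate function $f_n$ satisfies: 1. $f_n$ is strictly concave on $[0,1]$. 2. On $[0,\infty)$, $f_n$ is either concave and increasing, or unimodal. 3. The sign of the second derivative $f_n''(\rho)$ changes at most once over $[0,\infty)$.
   Context: $R,C,\mu>0$ are fixed real constants (reward, waiting cost per unit time, service rate). For an integer $n\ge 0$, the social benefit rate function $f_n:[0,\infty)\to\mathbb R$ is $$f_n(\rho)=R\mu\,\frac{\rho(1-\rho^n)}{1-\rho^{n+1}}-C\left(\frac{\rho}{1-\rho}-\frac{(n+1)\rho^{n+1}}{1-\rho^{n+1}}\right)\ (\rho\ne 1),\qquad f_n(1)=R\mu\,\frac{n}{n+1}-C\,\frac n2 .$$ A function on $[0,\infty)$ is unimodal if there is a point before which it is increasing and after which it is decreasing. *)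

theory Defs
  imports "HOL-Analysis.Analysis"
begin

definition social_benefit :: "real \<Rightarrow> real \<Rightarrow> real \<Rightarrow> nat \<Rightarrow> real \<Rightarrow> real" where
  "social_benefit R C \<mu> n \<rho> =
    (if \<rho> = 1 then R * \<mu> * (real n / (real n + 1)) - C * (real n / 2)
     else R * \<mu> * (\<rho> * (1 - \<rho> ^ n) / (1 - \<rho> ^ (n + 1)))
          - C * (\<rho> / (1 - \<rho>) - (real n + 1) * \<rho> ^ (n + 1) / (1 - \<rho> ^ (n + 1))))"

definition strictly_concave_on :: "real set \<Rightarrow> (real \<Rightarrow> real) \<Rightarrow> bool" where
  "strictly_concave_on S f \<longleftrightarrow> convex S \<and>
    (\<forall>x\<in>S. \<forall>y\<in>S. \<forall>t. x \<noteq> y \<and> 0 < t \<and> t < 1 \<longrightarrow>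
      (1 - t) * f x + t * f y < f ((1 - t) * x + t * y))"

text \<open>Monotonicity is strict on both sides, so that the mode is unique and constant
  functions do not qualify.\<close>

definition unimodal :: "(real \<Rightarrow> real) \<Rightarrow> bool" where
  "unimodal f \<longleftrightarrow> (\<exists>c\<ge>0. strict_mono_on {0..c} f \<and> strict_antimono_on {c..} f)"

text \<open>Zeros are disregarded: a second change of sign would show as three points at which
  nonzero values of strictly alternating sign are taken.\<close>

definition sign_changes_at_most_once_on :: "real set \<Rightarrow> (real \<Rightarrow> real) \<Rightarrow> bool" where
  "sign_changes_at_most_once_on S g \<longleftrightarrow>
    \<not> (\<exists>x\<in>S. \<exists>y\<in>S. \<exists>z\<in>S. x < y \<and> y < z \<and> g x * g y < 0 \<and> g y * g z < 0)"

text \<open>\<open>f''\<close> is the second derivative of \<open>f\<close> relative to \<open>S\<close>, hence one-sided at an endpoint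
  of \<open>S\<close>. If \<open>S\<close> has no isolated points, the values of \<open>f''\<close> on \<open>S\<close> are
  uniquely determined; those off \<open>S\<close> are arbitrary.\<close>

definition second_derivative_on :: "real set \<Rightarrow> (real \<Rightarrow> real) \<Rightarrow> (real \<Rightarrow> real) \<Rightarrow> bool" where
  "second_derivative_on S f f'' \<longleftrightarrow>
    (\<exists>f'. \<forall>x\<in>S. (f has_real_derivative f' x) (at x within S) \<and>
                (f' has_real_derivative f'' x) (at x within S))"

end

theory Submission
  imports Defs "HOL-Computational_Algebra.Polynomial_FPS"
begin

text \<open>With \<open>S = 1 + x + \<dots> + x\<^sup>n\<close>, \<open>N = n + 1\<close> and \<open>a = R \<mu> / C\<close>, the benefit is
  \<open>C (a - (a + x S') / S)\<close> on \<open>[0, \<infinity>)\<close>, so its first two derivatives are \<open>C P / S\<^sup>2\<close> and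
  \<open>C Q / S\<^sup>3\<close> with polynomials \<open>P\<close> and \<open>Q\<close>. Multiplying out the power series
  of \<open>1 / (1 - x)\<close> gives their coefficients in closed form: those of \<open>P\<close> change sign at most once,
  from positive to negative, and those of \<open>Q\<close> at most once, from negative to positive. As in
  Descartes' rule of signs, \<open>P\<close> and \<open>Q\<close> then change sign in the same way on \<open>[0, \<infinity>)\<close>. The sign
  of \<open>P\<close> gives unimodality, and strict concavity on \<open>[0, 1]\<close> follows
  from \<open>Q(1) = - N\<^sup>2 (N\<^sup>2 - 1) (2 a - N) / 12 < 0\<close>.\<close>

section \<open>Polynomials whose coefficients change sign at most once\<close>

text \<open>Only the direction from nonpositive to nonnegative is encoded, and constant sign is
  included. The opposite direction is handled by passing to \<open>- p\<close>.\<close>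

definition single_sign_change :: "real poly \<Rightarrow> bool" where
  "single_sign_change p \<longleftrightarrow>
    (\<exists>k. (\<forall>i<k. coeff p i \<le> 0) \<and> (\<forall>i\<ge>k. coeff p i \<ge> 0))"

text \<open>The threshold is the least index with a positive coefficient; if there is none, any
  index beyond the degree serves.\<close>

lemma single_sign_changeI:
  assumes "\<And>i j. i < j \<Longrightarrow> coeff p i > 0 \<Longrightarrow> coeff p j \<ge> 0"
  shows "single_sign_change p"
proof (cases "\<exists>i. coeff p i > 0")
  case True
  define k where "k = (LEAST i. coeff p i > 0)"
  have "coeff p k > 0"
    using True unfolding k_def by (rule LeastI_ex)
  moreover have "coeff p i \<le> 0" if "i < k" for i
    using not_less_Least[OF that[unfolded k_def]] by simp
  moreover have "coeff p i \<ge> 0" if "k \<le> i" for i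
    using that assms[of k i] \<open>coeff p k > 0\<close> by (cases "k = i") auto
  ultimately show ?thesis unfolding single_sign_change_def by blast
next
  case False
  then show ?thesis
    unfolding single_sign_change_def
    by (intro exI[of _ "Suc (degree p)"]) (auto simp: not_less coeff_eq_0)
qed

text \<open>This says that p(x) / x^k is nondecreasing, which holds termwise: below \<open>k\<close>
  a nonpositive coefficient multiplies a decreasing power, from \<open>k\<close> on a nonnegative
  one multiplies a nondecreasing power. Clearing denominators admits \<open>x = 0\<close>.\<close>

lemma single_sign_change_ratio:
  fixes p :: "real poly"
  assumes lo: "\<And>i. i < k \<Longrightarrow> coeff p i \<le> 0" and hi: "\<And>i. i \<ge> k \<Longrightarrow> coeff p i \<ge> 0"
    and xy: "0 \<le> x" "x \<le> y"
  shows "y ^ k * poly p x \<le> x ^ k * poly p y"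
proof -
  have "0 \<le> coeff p i * (x ^ k * y ^ i - y ^ k * x ^ i)" for i
  proof (cases "i < k")
    case True
    then obtain j where j: "k = i + j" using less_imp_add_positive by blast
    have "x ^ k * y ^ i - y ^ k * x ^ i = (x ^ i * y ^ i) * (x ^ j - y ^ j)"
      by (simp add: j power_add algebra_simps)
    moreover have "x ^ j - y ^ j \<le> 0" using xy by (simp add: power_mono)
    ultimately have "x ^ k * y ^ i - y ^ k * x ^ i \<le> 0"
      using xy by (simp add: mult_nonneg_nonpos)
    then show ?thesis using lo[OF True] by (rule mult_nonpos_nonpos[rotated])
  next
    case False
    then obtain j where j: "i = k + j" using le_Suc_ex not_less by blast
    have "x ^ k * y ^ i - y ^ k * x ^ i = (x ^ k * y ^ k) * (y ^ j - x ^ j)"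
      by (simp add: j power_add algebra_simps)
    moreover have "0 \<le> y ^ j - x ^ j" using xy by (simp add: power_mono)
    ultimately show ?thesis using hi[of i] False xy by simp
  qed
  then have "0 \<le> (\<Sum>i\<le>degree p. coeff p i * (x ^ k * y ^ i - y ^ k * x ^ i))"
    by (intro sum_nonneg)
  also have "\<dots> = x ^ k * poly p y - y ^ k * poly p x"
    by (simp add: poly_altdef sum_distrib_left sum_subtractf algebra_simps)
  finally show ?thesis by simp
qed

lemma single_sign_change_pos:
  assumes "single_sign_change p" "0 \<le> x" "x \<le> y" "poly p x > 0"
  shows "poly p y > 0"
proof -
  obtain k where k: "\<And>i. i < k \<Longrightarrow> coeff p i \<le> 0" "\<And>i. i \<ge> k \<Longrightarrow> coeff p i \<ge> 0"
    using assms(1) unfolding single_sign_change_def by blast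
  have le: "y ^ k * poly p x \<le> x ^ k * poly p y"
    by (rule single_sign_change_ratio[OF k assms(2,3)])
  show ?thesis
  proof (cases "y = 0")
    case True
    then show ?thesis using assms by auto
  next
    case False
    then have "0 < y ^ k * poly p x" using assms by simp
    then have "0 < x ^ k * poly p y" using le by linarith
    then show ?thesis using assms(2) by (auto simp: zero_less_mult_iff)
  qed
qed

text \<open>Cancelling \<open>x ^ k\<close> takes \<open>0 < x\<close>: the polynomial -X vanishes
  at 0 and is negative afterwards. The contrapositive carries negativity from \<open>y\<close> back
  to all of (0, y].\<close>

lemma single_sign_change_nonneg:
  assumes "single_sign_change p" "0 < x" "x \<le> y" "poly p x \<ge> 0"
  shows "poly p y \<ge> 0"
proof -
  obtain k where k: "\<And>i. i < k \<Longrightarrow> coeff p i \<le> 0" "\<And>i. i \<ge> k \<Longrightarrow> coeff p i \<ge> 0"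
    using assms(1) unfolding single_sign_change_def by blast
  have "y ^ k * poly p x \<le> x ^ k * poly p y"
    by (rule single_sign_change_ratio[OF k]) (use assms in auto)
  moreover have "0 \<le> y ^ k * poly p x" using assms by simp
  ultimately have "0 \<le> x ^ k * poly p y" by linarith
  moreover have "0 < x ^ k" using assms(2) by simp
  ultimately show ?thesis by (simp add: zero_le_mult_iff)
qed

text \<open>Removing the negative constant term before comparing makes the comparison strict.\<close>

lemma single_sign_change_strict:
  assumes "single_sign_change p" "coeff p 0 < 0" "0 < x" "x < y" "poly p x \<ge> 0"
  shows "poly p y > 0"
proof -
  obtain k where k: "\<And>i. i < k \<Longrightarrow> coeff p i \<le> 0" "\<And>i. i \<ge> k \<Longrightarrow> coeff p i \<ge> 0"
    using assms(1) unfolding single_sign_change_def by blast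
  have "k > 0" using k(2)[of 0] assms(2) by (cases k) auto
  define c where "c = coeff p 0"
  have "y ^ k * poly (p - [:c:]) x \<le> x ^ k * poly (p - [:c:]) y"
  proof (rule single_sign_change_ratio)
    show "coeff (p - [:c:]) i \<le> 0" if "i < k" for i
      using k(1)[OF that] by (auto simp: c_def coeff_pCons split: nat.split)
    show "coeff (p - [:c:]) i \<ge> 0" if "i \<ge> k" for i
      using k(2)[OF that] that \<open>k > 0\<close> by (auto simp: c_def coeff_pCons split: nat.split)
  qed (use assms in auto)
  then have "y ^ k * (poly p x - c) \<le> x ^ k * (poly p y - c)" by simp
  moreover have "0 \<le> y ^ k * poly p x" using assms by simp
  moreover have "x ^ k * (- c) < y ^ k * (- c)"
    using assms \<open>k > 0\<close> by (intro mult_strict_right_mono power_strict_mono) (auto simp: c_def)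
  ultimately have "0 < x ^ k * poly p y" by (simp add: algebra_simps)
  moreover have "0 < x ^ k" using assms(3) by simp
  ultimately show ?thesis by (rule zero_less_mult_pos)
qed

section \<open>The geometric sum, its derivatives and the numerators built from them\<close>

definition geo :: "nat \<Rightarrow> real poly" where
  "geo N = (\<Sum>k<N. monom 1 k)"

lemma one_minus_X_mult_geo: "[:1, -1:] * geo N = 1 - monom 1 N"
proof (induction N)
  case 0
  then show ?case by (simp add: geo_def)
next
  case (Suc N)
  have "[:1, -1:] * monom (1::real) N = monom 1 N - monom 1 (Suc N)"
    by (simp add: monom_Suc)
  with Suc show ?case by (simp add: geo_def distrib_left)
qed

text \<open>Differentiating the factor 1 - X contributes -q', and moving it to the right raises
  \<open>k\<close> by one. For \<open>m = 0\<close> the truncated \<open>m - 1\<close> does no harm,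
  since its coefficient is 0.\<close>

lemma pderiv_one_minus_X_mult:
  fixes p q :: "real poly"
  assumes "[:1, -1:] * pderiv q = of_nat k * q - monom c m"
  shows "[:1, -1:] * pderiv (pderiv q) = of_nat (Suc k) * pderiv q - monom (real m * c) (m - 1)"
proof -
  have "pderiv ([:1, -1:] * pderiv q) = [:1, -1:] * pderiv (pderiv q) - pderiv q"
    by (simp only: pderiv_mult) (simp add: pderiv_pCons)
  moreover have "pderiv (of_nat k * q - monom c m)
      = of_nat k * pderiv q - monom (real m * c) (m - 1)"
    by (simp add: pderiv_diff pderiv_mult pderiv_monom)
  ultimately have "[:1, -1:] * pderiv (pderiv q) - pderiv q
      = of_nat k * pderiv q - monom (real m * c) (m - 1)"
    using assms by simp
  then have "[:1, -1:] * pderiv (pderiv q)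
      = of_nat k * pderiv q - monom (real m * c) (m - 1) + pderiv q"
    by (simp only: diff_eq_eq)
  also have "\<dots> = of_nat (Suc k) * pderiv q - monom (real m * c) (m - 1)"
    by (simp add: distrib_right)
  finally show ?thesis .
qed

lemma one_minus_X_mult_geo':
  fixes N :: nat
  defines "r \<equiv> real N"
  shows "[:1, -1:] * pderiv (geo N) = geo N - monom r (N - 1)"
    and "[:1, -1:] * pderiv (pderiv (geo N)) = 2 * pderiv (geo N) - monom (r * (r - 1)) (N - 2)"
    and "[:1, -1:] * pderiv (pderiv (pderiv (geo N)))
      = 3 * pderiv (pderiv (geo N)) - monom (r * (r - 1) * (r - 2)) (N - 3)"
    and "[:1, -1:] * pderiv (pderiv (pderiv (pderiv (geo N))))
      = 4 * pderiv (pderiv (pderiv (geo N))) - monom (r * (r - 1) * (r - 2) * (r - 3)) (N - 4)"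
proof -
  have "pderiv ([:1, -1:] * geo N) = [:1, -1:] * pderiv (geo N) - geo N"
    by (simp only: pderiv_mult) (simp add: pderiv_pCons)
  moreover have "pderiv (1 - monom 1 N) = - monom r (N - 1)"
    by (simp add: pderiv_diff pderiv_monom r_def)
  ultimately have "[:1, -1:] * pderiv (geo N) - geo N = - monom r (N - 1)"
    by (simp only: one_minus_X_mult_geo)
  then have 1: "[:1, -1:] * pderiv (geo N) = of_nat 1 * geo N - monom r (N - 1)"
    by (simp only: diff_eq_eq) simp
  then show "[:1, -1:] * pderiv (geo N) = geo N - monom r (N - 1)" by simp
  \<comment> \<open>Differentiating monomials produces truncated differences. They may be replaced
    by real ones because, where they differ, another factor of the product vanishes; the same
    applies to the two similar equations below.\<close>
  have "real (N - 1) * r = r * (r - 1)" by (cases N) (auto simp: r_def)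
  then have 2: "[:1, -1:] * pderiv (pderiv (geo N))
      = of_nat 2 * pderiv (geo N) - monom (r * (r - 1)) (N - 2)"
    using pderiv_one_minus_X_mult[OF 1] by (simp only: numeral_eq_Suc diff_diff_left) simp
  then show "[:1, -1:] * pderiv (pderiv (geo N))
      = 2 * pderiv (geo N) - monom (r * (r - 1)) (N - 2)" by (simp only: of_nat_numeral)
  have "real (N - 2) * (r * (r - 1)) = r * (r - 1) * (r - 2)"
    by (cases "N \<ge> 2") (auto simp: r_def of_nat_diff not_le less_2_cases_iff)
  then have 3: "[:1, -1:] * pderiv (pderiv (pderiv (geo N)))
      = of_nat 3 * pderiv (pderiv (geo N)) - monom (r * (r - 1) * (r - 2)) (N - 3)"
    using pderiv_one_minus_X_mult[OF 2] by simp
  then show "[:1, -1:] * pderiv (pderiv (pderiv (geo N)))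
      = 3 * pderiv (pderiv (geo N)) - monom (r * (r - 1) * (r - 2)) (N - 3)"
    by (simp only: of_nat_numeral)
  have "N < 3 \<Longrightarrow> N = 0 \<or> N = 1 \<or> N = 2" by auto
  then have "real (N - 3) * (r * (r - 1) * (r - 2)) = r * (r - 1) * (r - 2) * (r - 3)"
    by (cases "N \<ge> 3") (auto simp: r_def of_nat_diff not_le)
  then have 4: "[:1, -1:] * pderiv (pderiv (pderiv (pderiv (geo N))))
      = of_nat 4 * pderiv (pderiv (pderiv (geo N))) - monom (r * (r - 1) * (r - 2) * (r - 3)) (N - 4)"
    using pderiv_one_minus_X_mult[OF 3] by simp
  then show "[:1, -1:] * pderiv (pderiv (pderiv (pderiv (geo N))))
      = 4 * pderiv (pderiv (pderiv (geo N))) - monom (r * (r - 1) * (r - 2) * (r - 3)) (N - 4)"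
    by (simp only: of_nat_numeral)
qed

text \<open>At 1 the factor 1 - X vanishes, so the identity for each derivative determines the value
  of the preceding one.\<close>

lemma poly_geo_1:
  fixes N :: nat
  defines "r \<equiv> real N"
  shows "poly (geo N) 1 = r"
    and "poly (pderiv (geo N)) 1 = r * (r - 1) / 2"
    and "poly (pderiv (pderiv (geo N))) 1 = r * (r - 1) * (r - 2) / 3"
    and "poly (pderiv (pderiv (pderiv (geo N)))) 1 = r * (r - 1) * (r - 2) * (r - 3) / 4"
  using one_minus_X_mult_geo'[of N, THEN arg_cong[of _ _ "\<lambda>p. poly p 1"]]
  by (simp_all add: r_def poly_monom)

lemma poly_geo_pos:
  assumes "N > 0" "x \<ge> 0"
  shows "poly (geo N) x > 0"
proof -
  have "poly (geo N) x = (\<Sum>k<N. x ^ k)" by (simp add: geo_def poly_sum poly_monom)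
  also have "\<dots> \<ge> (\<Sum>k<1. x ^ k)" using assms by (intro sum_mono2) auto
  finally show ?thesis by simp
qed

text \<open>The first two derivatives of \<open>a - (a + x S') / S\<close>, where \<open>S\<close> is \<^term>\<open>geo N\<close>, are
  \<open>numer' / S\<^sup>2\<close> and \<open>numer'' / S\<^sup>3\<close>.\<close>

definition numer' :: "real \<Rightarrow> nat \<Rightarrow> real poly" where
  "numer' a N = smult a (pderiv (geo N))
     - ((pderiv (geo N) + [:0, 1:] * pderiv (pderiv (geo N))) * geo N
        - [:0, 1:] * (pderiv (geo N))\<^sup>2)"

definition numer'' :: "real \<Rightarrow> nat \<Rightarrow> real poly" where
  "numer'' a N = pderiv (numer' a N) * geo N - 2 * numer' a N * pderiv (geo N)"

text \<open>In the product rule the two squares of S' cancel, and only one of two copies of x S' S''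
  survives.\<close>

lemma pderiv_numer':
  "pderiv (numer' a N) = smult a (pderiv (pderiv (geo N)))
     - ((2 * pderiv (pderiv (geo N)) + [:0, 1:] * pderiv (pderiv (pderiv (geo N)))) * geo N
        - [:0, 1:] * pderiv (geo N) * pderiv (pderiv (geo N)))"
proof -
  have "pderiv ([:0, 1:] :: real poly) = 1" by (simp add: pderiv_pCons)
  then show ?thesis
    unfolding numer'_def power2_eq_square pderiv_diff pderiv_add pderiv_mult pderiv_smult
    by (simp add: algebra_simps del: mult_pCons_left mult_pCons_right)
qed

lemma poly_numer''_1:
  fixes N :: nat
  defines "r \<equiv> real N"
  shows "poly (numer'' a N) 1 = - r\<^sup>2 * (r\<^sup>2 - 1) * (2 * a - r) / 12"
  unfolding numer''_def pderiv_numer' unfolding numer'_def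
  by (simp add: poly_geo_1 r_def[symmetric] del: mult_pCons_left mult_pCons_right)
    (simp add: field_simps power2_eq_square)

section \<open>Coefficients of the numerators via powers of 1 / (1 - x)\<close>

abbreviation fps_geo :: "real fps" where
  "fps_geo \<equiv> inverse (1 - fps_X)"

lemma fps_geo_mult: "fps_geo * (1 - fps_X) = 1"
  by (rule inverse_mult_eq_1) simp

text \<open>The right side is the binomial coefficient of m + k over k. Multiplying its generating
  series by 1 - x lowers \<open>k\<close> by one, which is Pascal's rule.\<close>

lemma fps_geo_power_Suc_nth:
  "fps_nth (fps_geo ^ Suc k) m = pochhammer (real m + 1) k / fact k"
proof -
  define F where "F k = Abs_fps (\<lambda>m. pochhammer (real m + 1) k / fact k)" for k
  have step: "(1 - fps_X) * F (Suc k) = F k" for k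
  proof (rule fps_ext)
    fix m
    show "fps_nth ((1 - fps_X) * F (Suc k)) m = fps_nth (F k) m"
    proof (cases m)
      case 0
      then show ?thesis
        by (simp add: F_def left_diff_distrib pochhammer_fact[symmetric])
    next
      case (Suc j)
      \<comment> \<open>Pascal's rule for rising factorials: both have the common factor
        \<open>pochhammer (real j + 2) k\<close>.\<close>
      have *: "pochhammer (real j + 2) (Suc k) - pochhammer (real j + 1) (Suc k)
          = real (Suc k) * pochhammer (real j + 2) k"
        using pochhammer_rec[of "real j + 1" k] pochhammer_Suc[of "real j + 2" k]
        by (simp add: algebra_simps)
      have "fps_nth ((1 - fps_X) * F (Suc k)) m
          = (pochhammer (real j + 2) (Suc k) - pochhammer (real j + 1) (Suc k)) / fact (Suc k)"
        by (simp add: F_def left_diff_distrib Suc diff_divide_distrib add_ac del: fact_Suc)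
      also have "\<dots> = pochhammer (real j + 2) k / fact k"
        unfolding * by (simp del: of_nat_Suc)
      finally show ?thesis by (simp add: F_def Suc add_ac)
    qed
  qed
  have "fps_geo ^ Suc k = F k" for k
  proof (induction k)
    case 0
    have "(1 - fps_X) * F 0 = 1"
      by (rule fps_ext) (simp add: F_def left_diff_distrib)
    then have "fps_geo * ((1 - fps_X) * F 0) = fps_geo" by simp
    then show ?case by (simp only: mult.assoc[symmetric] fps_geo_mult) simp
  next
    case (Suc k)
    have "fps_geo ^ Suc (Suc k) = fps_geo * ((1 - fps_X) * F (Suc k))"
      using Suc step by simp
    then show ?case by (simp only: mult.assoc[symmetric] fps_geo_mult) simp
  qed
  then show ?thesis by (simp add: F_def)
qed


lemma fps_geo_mult_X: "fps_geo * fps_X = fps_geo - 1"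
  using fps_geo_mult by (simp add: algebra_simps)

lemma eq_fps_geo_mult:
  assumes "(1 - fps_X) * f = g"
  shows "f = fps_geo * g"
  using assms fps_geo_mult by (metis mult.assoc mult_1)

lemma fps_of_poly_one_minus_X: "fps_of_poly [:1, -1 :: real:] = 1 - fps_X"
  by (rule fps_ext) (auto simp: coeff_pCons split: nat.split)

text \<open>Undoes truncated subtraction in the exponent: where \<open>N - k\<close> is cut off at
  0, the coefficient is 0 anyway.\<close>

lemma fps_const_mult_X_power_diff:
  assumes "N < k \<Longrightarrow> c = 0"
  shows "fps_X ^ k * (fps_const c * fps_X ^ (N - k)) = fps_const c * (fps_X ^ N :: real fps)"
  using assms by (cases "N < k") (auto simp: power_add[symmetric] mult.left_commute)

text \<open>Weighting the k-th derivative with x^k turns the correction term X^(N - k) into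
  \<open>y\<close>, and x / (1 - x) = 1 / (1 - x) - 1 removes the remaining powers of x. Everything
  becomes a polynomial in \<open>fps_geo\<close>, \<open>y\<close> and \<open>c\<close>, within
  reach of \<open>algebra\<close>.\<close>

lemma fps_of_poly_geo:
  fixes N :: nat
  defines "c \<equiv> fps_const (real N)" and "y \<equiv> fps_X ^ N"
    and "t \<equiv> \<lambda>k. fps_X ^ k * fps_of_poly ((pderiv ^^ k) (geo N))"
  shows "fps_of_poly (geo N) = fps_geo * (1 - y)"
    and "t 1 = (fps_geo - 1) * fps_of_poly (geo N) - c * fps_geo * y"
    and "t 2 = 2 * (fps_geo - 1) * t 1 - c * (c - 1) * fps_geo * y"
    and "t 3 = 3 * (fps_geo - 1) * t 2 - c * (c - 1) * (c - 2) * fps_geo * y"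
proof -
  let ?f = fps_of_poly and ?X = "fps_X :: real fps" and ?r = "real N"
  let ?g = "geo N"
  note f_simps = fps_of_poly_mult fps_of_poly_diff fps_of_poly_one_minus_X fps_of_poly_monom
  have c: "c - 1 = fps_const (?r - 1)" "c - 2 = fps_const (?r - 2)"
    by (simp_all add: c_def fps_numeral_fps_const flip: fps_const_1_eq_1)
  have "(1 - ?X) * ?f ?g = 1 - y"
    using arg_cong[OF one_minus_X_mult_geo[of N], of ?f] by (simp only: f_simps y_def) simp
  then show "?f ?g = fps_geo * (1 - y)" by (rule eq_fps_geo_mult)
  have X1: "?X * (fps_const ?r * ?X ^ (N - 1)) = c * y"
    using fps_const_mult_X_power_diff[of N 1 ?r] by (cases "N = 0") (auto simp: c_def y_def)
  have "(1 - ?X) * ?f (pderiv ?g) = ?f ?g - fps_const ?r * ?X ^ (N - 1)"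
    using arg_cong[OF one_minus_X_mult_geo'(1)[of N], of ?f] by (simp only: f_simps)
  then have "(1 - ?X) * t 1 = ?X * (?f ?g - fps_const ?r * ?X ^ (N - 1))"
    unfolding t_def by (simp add: mult.left_commute)
  also have "\<dots> = ?X * ?f ?g - c * y" by (simp only: right_diff_distrib X1)
  finally have "t 1 = fps_geo * (?X * ?f ?g - c * y)" by (rule eq_fps_geo_mult)
  also have "\<dots> = (fps_geo * ?X) * ?f ?g - c * fps_geo * y" by (simp add: algebra_simps)
  finally show "t 1 = (fps_geo - 1) * ?f ?g - c * fps_geo * y"
    by (simp only: fps_geo_mult_X)
  have X2: "?X ^ 2 * (fps_const (?r * (?r - 1)) * ?X ^ (N - 2)) = c * (c - 1) * y"
    by (subst fps_const_mult_X_power_diff) (auto simp: c c_def y_def less_2_cases_iff)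
  have "(1 - ?X) * ?f (pderiv (pderiv ?g))
      = 2 * ?f (pderiv ?g) - fps_const (?r * (?r - 1)) * ?X ^ (N - 2)"
    using arg_cong[OF one_minus_X_mult_geo'(2)[of N], of ?f]
    by (simp only: f_simps fps_of_poly_numeral)
  then have "(1 - ?X) * t 2
      = ?X ^ 2 * (2 * ?f (pderiv ?g) - fps_const (?r * (?r - 1)) * ?X ^ (N - 2))"
    unfolding t_def by (simp add: mult.left_commute numeral_2_eq_2)
  also have "\<dots> = 2 * ?X * t 1 - c * (c - 1) * y"
    by (simp only: right_diff_distrib[of "?X ^ 2"] X2) (simp add: t_def power2_eq_square algebra_simps)
  finally have "t 2 = fps_geo * (2 * ?X * t 1 - c * (c - 1) * y)" by (rule eq_fps_geo_mult)
  also have "\<dots> = 2 * (fps_geo * ?X) * t 1 - c * (c - 1) * fps_geo * y"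
    by (simp add: algebra_simps)
  finally show "t 2 = 2 * (fps_geo - 1) * t 1 - c * (c - 1) * fps_geo * y"
    by (simp only: fps_geo_mult_X)
  have "N < 3 \<Longrightarrow> N = 0 \<or> N = 1 \<or> N = 2" by auto
  then have X3: "?X ^ 3 * (fps_const (?r * (?r - 1) * (?r - 2)) * ?X ^ (N - 3))
      = c * (c - 1) * (c - 2) * y"
    by (subst fps_const_mult_X_power_diff) (auto simp: c c_def y_def)
  have "(1 - ?X) * ?f (pderiv (pderiv (pderiv ?g)))
      = 3 * ?f (pderiv (pderiv ?g)) - fps_const (?r * (?r - 1) * (?r - 2)) * ?X ^ (N - 3)"
    using arg_cong[OF one_minus_X_mult_geo'(3)[of N], of ?f]
    by (simp only: f_simps fps_of_poly_numeral)
  then have "(1 - ?X) * t 3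
      = ?X ^ 3 * (3 * ?f (pderiv (pderiv ?g))
          - fps_const (?r * (?r - 1) * (?r - 2)) * ?X ^ (N - 3))"
    unfolding t_def by (simp add: mult.left_commute numeral_3_eq_3)
  also have "\<dots> = 3 * ?X * t 2 - c * (c - 1) * (c - 2) * y"
    by (simp only: right_diff_distrib[of "?X ^ 3"] X3)
      (simp add: t_def numeral_2_eq_2 numeral_3_eq_3 algebra_simps)
  finally have "t 3 = fps_geo * (3 * ?X * t 2 - c * (c - 1) * (c - 2) * y)"
    by (rule eq_fps_geo_mult)
  also have "\<dots> = 3 * (fps_geo * ?X) * t 2 - c * (c - 1) * (c - 2) * fps_geo * y"
    by (simp add: algebra_simps)
  finally show "t 3 = 3 * (fps_geo - 1) * t 2 - c * (c - 1) * (c - 2) * fps_geo * y"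
    by (simp only: fps_geo_mult_X)
qed

text \<open>One factor x is just enough to pair every k-th derivative in the numerator with x^k; for
  \<open>numer''\<close> two factors are.\<close>

lemma fps_of_poly_numer':
  fixes a :: real and N :: nat
  defines "c \<equiv> fps_const (real N)" and "y \<equiv> fps_X ^ N"
  shows "fps_X * fps_of_poly (numer' a N)
    = fps_const a * ((fps_geo\<^sup>2 - fps_geo) * (1 - y) - c * fps_geo * y)
      - ((fps_geo ^ 4 - fps_geo ^ 3) * (1 - y)\<^sup>2 - c\<^sup>2 * fps_geo\<^sup>2 * y)"
proof -
  define s where "s = fps_of_poly (geo N)"
  define t where "t k = fps_X ^ k * fps_of_poly ((pderiv ^^ k) (geo N))" for k
  define G :: "real fps" where "G = fps_geo"
  note eqs = fps_of_poly_geo[of N, folded s_def t_def c_def y_def G_def]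
  have "fps_X * fps_of_poly (numer' a N) = fps_const a * t 1 - ((t 1 + t 2) * s - (t 1)\<^sup>2)"
    unfolding numer'_def t_def s_def
    by (simp add: fps_of_poly_mult fps_of_poly_diff fps_of_poly_add fps_of_poly_smult
        fps_of_poly_power numeral_2_eq_2 algebra_simps del: mult_pCons_left mult_pCons_right)
  also have "\<dots> = fps_const a * ((G\<^sup>2 - G) * (1 - y) - c * G * y)
      - ((G ^ 4 - G ^ 3) * (1 - y)\<^sup>2 - c\<^sup>2 * G\<^sup>2 * y)"
    unfolding eqs by algebra
  finally show ?thesis unfolding G_def .
qed

lemma fps_of_poly_numer'':
  fixes a :: real and N :: nat
  defines "c \<equiv> fps_const (real N)" and "y \<equiv> fps_X ^ N"
  shows "fps_X\<^sup>2 * fps_of_poly (numer'' a N)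
    = - fps_const a * (c * y * ((c - 1) + (c + 1) * y) * fps_geo\<^sup>2
          - 2 * c * y * (1 - y) * (fps_geo ^ 3 - fps_geo\<^sup>2))
      - (2 * (fps_geo ^ 6 - 2 * fps_geo ^ 5 + fps_geo ^ 4) * (1 - y) ^ 3
          - c\<^sup>2 * y * ((c - 1) + (c + 1) * y) * fps_geo ^ 3)"
proof -
  define s where "s = fps_of_poly (geo N)"
  define t where "t k = fps_X ^ k * fps_of_poly ((pderiv ^^ k) (geo N))" for k
  define G :: "real fps" where "G = fps_geo"
  note eqs = fps_of_poly_geo[of N, folded s_def t_def c_def y_def G_def]
  have "fps_X\<^sup>2 * fps_of_poly (numer'' a N)
      = fps_const a * (t 2 * s - 2 * (t 1)\<^sup>2)
        - ((2 * t 2 + t 3) * s\<^sup>2 - 3 * t 1 * t 2 * s - 2 * (t 1)\<^sup>2 * s + 2 * (t 1) ^ 3)"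
    unfolding numer''_def pderiv_numer' unfolding numer'_def t_def s_def
    by (simp add: fps_of_poly_mult fps_of_poly_diff fps_of_poly_add fps_of_poly_smult
        fps_of_poly_power numeral_2_eq_2 numeral_3_eq_3 algebra_simps
        del: mult_pCons_left mult_pCons_right)
  also have "\<dots> = - fps_const a * (c * y * ((c - 1) + (c + 1) * y) * G\<^sup>2
          - 2 * c * y * (1 - y) * (G ^ 3 - G\<^sup>2))
      - (2 * (G ^ 6 - 2 * G ^ 5 + G ^ 4) * (1 - y) ^ 3
          - c\<^sup>2 * y * ((c - 1) + (c + 1) * y) * G ^ 3)"
    unfolding eqs by algebra
  finally show ?thesis unfolding G_def .
qed


lemma fps_geo_power_nth:
  "fps_nth fps_geo m = 1"
  "fps_nth (fps_geo\<^sup>2) m = real m + 1"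
  "fps_nth (fps_geo ^ 3) m = (real m + 1) * (real m + 2) / 2"
  "fps_nth (fps_geo ^ 4) m = (real m + 1) * (real m + 2) * (real m + 3) / 6"
  "fps_nth (fps_geo ^ 5) m = (real m + 1) * (real m + 2) * (real m + 3) * (real m + 4) / 24"
  "fps_nth (fps_geo ^ 6) m
    = (real m + 1) * (real m + 2) * (real m + 3) * (real m + 4) * (real m + 5) / 120"
  using fps_geo_power_Suc_nth[of 0 m] fps_geo_power_Suc_nth[of 1 m] fps_geo_power_Suc_nth[of 2 m] fps_geo_power_Suc_nth[of 3 m]
    fps_geo_power_Suc_nth[of 4 m] fps_geo_power_Suc_nth[of 5 m]
  by (simp_all add: pochhammer_Suc fact_numeral eval_nat_numeral add_ac)

text \<open>Sorted by powers of \<open>y\<close>, the series is a sum of sequences that start at 0,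
  N and 2 N; hence the ranges. The factor x shifts the index to \<open>m = i + 1\<close>. From N on
  the terms with \<open>a\<close> cancel.\<close>

lemma coeff_numer':
  fixes a :: real and N i :: nat
  defines "m \<equiv> real (Suc i)" and "r \<equiv> real N"
  shows "coeff (numer' a N) i =
    (if Suc i < N then m * (a - (m + 1) * (m + 2) / 6)
     else if Suc i < 2 * N then - (2 * r - 2 - m) * (2 * r - 1 - m) * (2 * r - m) / 6
     else 0)"
proof -
  define y where "y = (fps_X :: real fps) ^ N"
  \<comment> \<open>This is x / (1 - x)^4, with the binomial coefficients of k + 2 over 3.\<close>
  define J where "J = fps_geo ^ 4 - fps_geo ^ 3"
  have J: "fps_nth J k = real k * (real k + 1) * (real k + 2) / 6" for k
    by (simp add: J_def fps_geo_power_nth) (simp add: field_simps)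
  have c: "fps_const (a - a * r) = fps_const a - fps_const a * fps_const r"
    "fps_const (r\<^sup>2) = (fps_const r)\<^sup>2" "fps_const (-a) = - fps_const a" "fps_const 2 = (2 :: real fps)"
    by (simp_all add: fps_numeral_fps_const power2_eq_square)
  have y2: "y * y = fps_X ^ (2 * N)"
    by (simp add: y_def mult_2 power_add)
  have "fps_X * fps_of_poly (numer' a N) = fps_const a * fps_geo\<^sup>2 - fps_const a * fps_geo - J
      + y * (fps_const (- a) * fps_geo\<^sup>2 + fps_const (a - a * r) * fps_geo + fps_const 2 * J
          + fps_const (r\<^sup>2) * fps_geo\<^sup>2)
      - (y * y) * J"
    unfolding fps_of_poly_numer' J_def c y_def[symmetric] r_def[symmetric] by algebra
  then have "fps_nth (fps_X * fps_of_poly (numer' a N)) (Suc i)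
    = fps_nth (fps_const a * fps_geo\<^sup>2 - fps_const a * fps_geo - J
      + y * (fps_const (- a) * fps_geo\<^sup>2 + fps_const (a - a * r) * fps_geo + fps_const 2 * J
          + fps_const (r\<^sup>2) * fps_geo\<^sup>2)
      - (y * y) * J) (Suc i)"
    by (rule arg_cong)
  then have eq: "coeff (numer' a N) i = a * (m + 1) - a - m * (m + 1) * (m + 2) / 6
     + (if Suc i < N then 0 else
         let d = m - r in - a * (d + 1) + (a - a * r) + 2 * (d * (d + 1) * (d + 2) / 6) + r\<^sup>2 * (d + 1))
     - (if Suc i < 2 * N then 0 else let d = m - 2 * r in d * (d + 1) * (d + 2) / 6)"
    unfolding y2 unfolding y_def
    by (simp add: J fps_X_power_mult_nth fps_geo_power_nth
        m_def r_def of_nat_diff Let_def del: of_nat_Suc fps_const_neg fps_const_sub)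
  show ?thesis
    unfolding eq Let_def by (auto simp: field_simps power2_eq_square)
qed

text \<open>As for \<open>numer'\<close>, with sequences that start at 0, N, 2 N and 3 N and with
  \<open>m = i + 2\<close>. \<open>K x\<close> is the binomial coefficient of x + 3 over 5, and
  \<open>u\<close> runs from 1 to N over the middle range, the only one where \<open>a\<close>
  occurs.\<close>

lemma coeff_numer'':
  fixes a :: real and N i :: nat
  defines "m \<equiv> real (i + 2)" and "r \<equiv> real N"
    and "K \<equiv> \<lambda>x::real. (x - 1) * x * (x + 1) * (x + 2) * (x + 3) / 120"
    and "u \<equiv> real (i + 2) + 1 - real N"
  shows "coeff (numer'' a N) i =
    (if i + 2 < N then - 2 * K m
     else if i + 2 < 2 * N
       then - (a * r * u * (r - u) + 2 * K (u + r - 1) - 6 * K (u - 1) - r\<^sup>2 * (r - 1) * u * (u + 1) / 2)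
     else if i + 2 < 3 * N then 2 * K (3 * r - 2 - m)
     else 0)"
proof -
  define y where "y = (fps_X :: real fps) ^ N"
  \<comment> \<open>This is x^2 / (1 - x)^6, whose coefficients are the values of
    \<open>K\<close>.\<close>
  define J where "J = fps_geo ^ 6 - 2 * fps_geo ^ 5 + fps_geo ^ 4"
  have "J = fps_geo ^ 6 - fps_const 2 * fps_geo ^ 5 + fps_geo ^ 4"
    by (simp add: J_def fps_numeral_fps_const)
  then have J: "fps_nth J k = K (real k)" for k
    by (simp add: K_def fps_geo_power_nth) (simp add: field_simps)
  \<comment> \<open>\<open>A1\<close>, \<open>B1\<close> collect the coefficients of the square and
    the cube of \<open>fps_geo\<close> at \<open>y\<close>, and \<open>A2\<close>, \<open>B2\<close>
    those at the square of \<open>y\<close>.\<close>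
  define A1 where "A1 = - (a * r * (r + 1))"
  define B1 where "B1 = 2 * a * r + r\<^sup>2 * (r - 1)"
  define A2 where "A2 = - (a * r * (r - 1))"
  define B2 where "B2 = r\<^sup>2 * (r + 1) - 2 * a * r"
  have c: "fps_const A1 = - (fps_const a * fps_const r * (fps_const r + 1))"
    "fps_const B1 = 2 * fps_const a * fps_const r + (fps_const r)\<^sup>2 * (fps_const r - 1)"
    "fps_const A2 = - (fps_const a * fps_const r * (fps_const r - 1))"
    "fps_const B2 = (fps_const r)\<^sup>2 * (fps_const r + 1) - 2 * fps_const a * fps_const r"
    by (simp_all add: A1_def B1_def A2_def B2_def fps_numeral_fps_const power2_eq_square
        flip: fps_const_1_eq_1)
  have n: "fps_const 2 = (2 :: real fps)" "fps_const 6 = (6 :: real fps)"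
    by (simp_all add: fps_numeral_fps_const)
  have y2: "y * y = fps_X ^ (2 * N)" and y3: "y * y * y = fps_X ^ (3 * N)"
    by (simp_all add: y_def power_add[symmetric])
  have "fps_X\<^sup>2 * fps_of_poly (numer'' a N) =
      - (fps_const 2 * J)
      + y * (fps_const A1 * fps_geo\<^sup>2 + fps_const B1 * fps_geo ^ 3 + fps_const 6 * J)
      + (y * y) * (fps_const A2 * fps_geo\<^sup>2 + fps_const B2 * fps_geo ^ 3 - fps_const 6 * J)
      + (y * y * y) * (fps_const 2 * J)"
    unfolding fps_of_poly_numer'' J_def c n y_def[symmetric] r_def[symmetric] by algebra
  then have "fps_nth (fps_X\<^sup>2 * fps_of_poly (numer'' a N)) (i + 2) = fps_nth (
      - (fps_const 2 * J)
      + y * (fps_const A1 * fps_geo\<^sup>2 + fps_const B1 * fps_geo ^ 3 + fps_const 6 * J)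
      + (y * y) * (fps_const A2 * fps_geo\<^sup>2 + fps_const B2 * fps_geo ^ 3 - fps_const 6 * J)
      + (y * y * y) * (fps_const 2 * J)) (i + 2)"
    by (rule arg_cong)
  then have eq: "coeff (numer'' a N) i = - 2 * K m
     + (if i + 2 < N then 0 else
         let d = m - r in A1 * (d + 1) + B1 * ((d + 1) * (d + 2) / 2) + 6 * K d)
     + (if i + 2 < 2 * N then 0 else
         let d = m - 2 * r in A2 * (d + 1) + B2 * ((d + 1) * (d + 2) / 2) - 6 * K d)
     + (if i + 2 < 3 * N then 0 else let d = m - 3 * r in 2 * K d)"
    unfolding y3 unfolding y2 unfolding y_def
    by (simp add: J fps_X_power_mult_nth fps_geo_power_nth
        m_def r_def of_nat_diff Let_def del: of_nat_add)
  have mu: "m = u + r - 1" by (simp add: m_def u_def r_def)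
  consider "i + 2 < N" | "N \<le> i + 2" "i + 2 < 2 * N" | "2 * N \<le> i + 2" "i + 2 < 3 * N"
    | "3 * N \<le> i + 2" by linarith
  then show ?thesis
  proof cases
    case 1
    then show ?thesis unfolding eq by simp
  next
    case 2
    have "- 2 * K m + (A1 * (m - r + 1) + B1 * ((m - r + 1) * (m - r + 2) / 2) + 6 * K (m - r))
      = - (a * r * u * (r - u) + 2 * K (u + r - 1) - 6 * K (u - 1) - r\<^sup>2 * (r - 1) * u * (u + 1) / 2)"
      unfolding mu A1_def B1_def by (simp add: field_simps power2_eq_square)
    with 2 show ?thesis unfolding eq by (simp add: Let_def)
  next
    case 3
    have "- 2 * K m + (A1 * (m - r + 1) + B1 * ((m - r + 1) * (m - r + 2) / 2) + 6 * K (m - r))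
       + (A2 * (m - 2 * r + 1) + B2 * ((m - 2 * r + 1) * (m - 2 * r + 2) / 2) - 6 * K (m - 2 * r))
      = 2 * K (3 * r - 2 - m)"
      unfolding K_def A1_def B1_def A2_def B2_def by (simp add: field_simps power2_eq_square)
    with 3 show ?thesis unfolding eq by (simp add: Let_def)
  next
    case 4
    \<comment> \<open>All four sequences are active here and cancel identically as polynomials in
      \<open>m\<close>, which bounds the degree.\<close>
    have "- 2 * K m + (A1 * (m - r + 1) + B1 * ((m - r + 1) * (m - r + 2) / 2) + 6 * K (m - r))
       + (A2 * (m - 2 * r + 1) + B2 * ((m - 2 * r + 1) * (m - 2 * r + 2) / 2) - 6 * K (m - 2 * r))
       + 2 * K (m - 3 * r) = 0"
      unfolding K_def A1_def B1_def A2_def B2_def by (simp add: field_simps power2_eq_square)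
    with 4 show ?thesis unfolding eq by (simp add: Let_def)
  qed
qed


section \<open>Sign patterns of the coefficients\<close>

text \<open>In the low range the sign of a coefficient of \<open>numer'\<close> is that of
  \<open>a\<close> minus an increasing quadratic in the index; from N on all coefficients are
  nonpositive.\<close>

lemma single_sign_change_numer':
  assumes "N > 0"
  shows "single_sign_change (- numer' a N)"
proof (rule single_sign_changeI)
  fix i j :: nat
  assume ij: "i < j" and pos: "coeff (- numer' a N) i > 0"
  consider "Suc j < N" | "N \<le> Suc j" "Suc j < 2 * N" | "2 * N \<le> Suc j" by linarith
  then show "coeff (- numer' a N) j \<ge> 0"
  proof cases
    case 1
    then have "real (Suc i) * (a - (real (Suc i) + 1) * (real (Suc i) + 2) / 6) < 0"
      using pos ij by (simp add: coeff_numer' del: of_nat_Suc)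
    then have "a < (real (Suc i) + 1) * (real (Suc i) + 2) / 6"
      by (simp add: mult_less_0_iff)
    also have "\<dots> \<le> (real (Suc j) + 1) * (real (Suc j) + 2) / 6"
      using ij by (intro divide_right_mono mult_mono) auto
    finally have "real (Suc j) * (a - (real (Suc j) + 1) * (real (Suc j) + 2) / 6) \<le> 0"
      by (intro mult_nonneg_nonpos) auto
    with 1 show ?thesis by (simp add: coeff_numer' del: of_nat_Suc)
  next
    case 2
    \<comment> \<open>Counting from the top turns the coefficient into a product of three
      consecutive integers, nonnegative for natural \<open>v\<close>, up to the factor -1/6.\<close>
    define v where "v = 2 * N - 1 - Suc j"
    have "0 \<le> (real v - 1) * real v * (real v + 1)" by (cases v) auto
    moreover have "coeff (numer' a N) j = - ((real v - 1) * real v * (real v + 1)) / 6"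
    proof -
      have "real v = 2 * real N - 1 - real (Suc j)"
        using 2 by (simp add: v_def of_nat_diff)
      then have "2 * real N - 2 - real (Suc j) = real v - 1" "2 * real N - 1 - real (Suc j) = real v"
        "2 * real N - real (Suc j) = real v + 1" by simp_all
      then show ?thesis using 2 by (simp only: coeff_numer') (simp, simp add: algebra_simps)
    qed
    ultimately show ?thesis by simp
  next
    case 3
    then show ?thesis by (simp add: coeff_numer')
  qed
qed

text \<open>Here \<open>g\<close> gives the coefficients of \<^const>\<open>numer''\<close> in the middle range, where
  \<open>u\<close> runs from \<open>1\<close> to \<open>r = N\<close>. Up to a constant factor, \<open>g u\<close> divided by \<open>- u * (r - u)\<close> is a
  decreasing cubic plus a nonnegative multiple of the decreasing function
  \<open>1 / u - 1 / (r - u)\<close>.\<close>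

lemma middle_coeff_mono:
  fixes a r u v :: real and g K :: "real \<Rightarrow> real"
  defines "K \<equiv> \<lambda>x. (x - 1) * x * (x + 1) * (x + 2) * (x + 3) / 120"
  defines "g \<equiv> \<lambda>u. - (a * r * u * (r - u) + 2 * K (u + r - 1) - 6 * K (u - 1)
    - r\<^sup>2 * (r - 1) * u * (u + 1) / 2)"
  assumes "r \<ge> 2" "0 < u" "u < v" "v < r" "g u > 0"
  shows "g v > 0"
proof -
  \<comment> \<open>\<open>b * (2 * w - r)\<close> is the remainder of \<open>60 * g w\<close>
    modulo \<open>w * (r - w)\<close>, the linear interpolation of its values at 0 and
    \<open>r\<close>; \<open>- (60 * a * r + c w)\<close> is the quotient. Partial fractions of the
    remainder term give \<open>h\<close>.\<close>
  define b where "b = (r\<^sup>2 - 1) * (r\<^sup>2 - 4)"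
  define c where "c u = 2 * u ^ 3 - 3 * r * u\<^sup>2 - (13 * r\<^sup>2 + 10) * u + (7 * r ^ 3 - 30 * r\<^sup>2 + 5 * r)"
    for u
  define h where "h u = - (60 * a * r + c u) + b * (1 / (r - u) - 1 / u)" for u
  have g: "60 * g w = w * (r - w) * h w" if "0 < w" "w < r" for w
  proof -
    have "w * (r - w) * (1 / (r - w) - 1 / w) = 2 * w - r"
      using that by (simp add: field_simps)
    then have "w * (r - w) * (b * (1 / (r - w) - 1 / w)) = b * (2 * w - r)"
      by (metis mult.left_commute)
    then have "w * (r - w) * h w = - (w * (r - w) * (60 * a * r + c w)) + b * (2 * w - r)"
      by (simp only: h_def distrib_left[of "w * (r - w)"] mult_minus_right)
    also have "\<dots> = 60 * g w"
      unfolding g_def K_def b_def c_def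
      by (simp add: field_simps power2_eq_square power3_eq_cube)
    finally show ?thesis ..
  qed
  have "u < r" "0 < v" using assms by auto
  have "0 < u * (r - u) * h u"
    unfolding g[OF \<open>0 < u\<close> \<open>u < r\<close>, symmetric] using \<open>g u > 0\<close> by simp
  moreover have "0 < u * (r - u)" using \<open>0 < u\<close> \<open>u < r\<close> by simp
  ultimately have "0 < h u" by (rule zero_less_mult_pos)
  also have "h u \<le> h v"
  proof -
    have "2\<^sup>2 \<le> r\<^sup>2" using \<open>r \<ge> 2\<close> by (intro power_mono) auto
    then have "b \<ge> 0" unfolding b_def by (intro mult_nonneg_nonneg) auto
    moreover have "1 / (r - u) - 1 / u \<le> 1 / (r - v) - 1 / v"
      using assms by (intro diff_mono divide_left_mono) auto
    ultimately have 1: "b * (1 / (r - u) - 1 / u) \<le> b * (1 / (r - v) - 1 / v)"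
      by (intro mult_left_mono)
    have "u\<^sup>2 \<le> r\<^sup>2" "v\<^sup>2 \<le> r\<^sup>2" "u * v \<le> r\<^sup>2"
      unfolding power2_eq_square using assms by (auto intro!: mult_mono)
    moreover have "0 \<le> 3 * r * (u + v)" "0 \<le> r\<^sup>2" using assms by simp_all
    ultimately have "0 \<le> 3 * r * (u + v) + 13 * r\<^sup>2 + 10 - 2 * (u\<^sup>2 + u * v + v\<^sup>2)"
      unfolding distrib_left[of 2] by linarith
    then have "0 \<le> (v - u) * (3 * r * (u + v) + 13 * r\<^sup>2 + 10 - 2 * (u\<^sup>2 + u * v + v\<^sup>2))"
      using assms by simp
    also have "\<dots> = c u - c v"
      unfolding c_def by (simp add: algebra_simps power2_eq_square power3_eq_cube)
    finally show ?thesis using 1 by (simp add: h_def)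
  qed
  finally have "0 < 60 * g v"
    unfolding g[OF \<open>0 < v\<close> \<open>v < r\<close>] using \<open>0 < v\<close> \<open>v < r\<close> by simp
  then show ?thesis by simp
qed

text \<open>Low coefficients are nonpositive and top ones nonnegative, so the only question is the
  middle range, which \<open>middle_coeff_mono\<close> settles except at
  \<open>u = r\<close>.\<close>

lemma single_sign_change_numer'':
  assumes "N \<ge> 2"
  shows "single_sign_change (numer'' a N)"
proof (rule single_sign_changeI)
  fix i j :: nat
  assume ij: "i < j" and pos: "coeff (numer'' a N) i > 0"
  define r where "r = real N"
  define K :: "real \<Rightarrow> real" where
    "K x = (x - 1) * x * (x + 1) * (x + 2) * (x + 3) / 120" for x
  define g where "g u = - (a * r * u * (r - u) + 2 * K (u + r - 1) - 6 * K (u - 1)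
    - r\<^sup>2 * (r - 1) * u * (u + 1) / 2)" for u
  define u where "u k = real (k + 2) + 1 - r" for k
  have coeff: "coeff (numer'' a N) k =
    (if k + 2 < N then - 2 * K (real (k + 2))
     else if k + 2 < 2 * N then g (u k)
     else if k + 2 < 3 * N then 2 * K (3 * r - 2 - real (k + 2))
     else 0)" for k
    unfolding coeff_numer'' g_def u_def K_def r_def by (rule refl)
  have "N \<le> i + 2"
  proof (rule ccontr)
    assume "\<not> N \<le> i + 2"
    moreover have "K (real (i + 2)) \<ge> 0" by (simp add: K_def)
    ultimately show False using pos by (simp add: coeff)
  qed
  with ij consider "j + 2 < 2 * N - 1" | "j + 2 = 2 * N - 1" | "2 * N \<le> j + 2" "j + 2 < 3 * N"
    | "3 * N \<le> j + 2" by linarith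
  then show "coeff (numer'' a N) j \<ge> 0"
  proof cases
    case 1
    have "r = real (2 * N - 1) + 1 - r" using assms by (simp add: r_def of_nat_diff)
    then have "u j < r" using 1 by (simp add: u_def)
    have range: "\<not> i + 2 < N" "i + 2 < 2 * N" "\<not> j + 2 < N" "j + 2 < 2 * N"
      using \<open>N \<le> i + 2\<close> 1 ij by auto
    have "g (u i) > 0" using pos range by (simp only: coeff if_True if_False)
    have "0 < u i" "u i < u j" using \<open>N \<le> i + 2\<close> ij by (auto simp: u_def r_def)
    then have "g (u j) > 0"
      using \<open>u j < r\<close> \<open>g (u i) > 0\<close> middle_coeff_mono[of r "u i" "u j" a] assms unfolding g_def K_def r_def by simp
    then show ?thesis using range by (simp only: coeff if_True if_False)
  next
    case 2
    \<comment> \<open>At the last middle index \<open>u = r\<close>, where \<open>r - u\<close>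
      vanishes: the term with \<open>a\<close> drops out and the value is explicit.\<close>
    then have "real (j + 2) = 2 * r - 1" using assms by (simp add: r_def of_nat_diff)
    then have "u j = r" by (simp add: u_def)
    then have "g (u j) = r * (r\<^sup>2 - 1) * (r\<^sup>2 - 4) / 60"
      by (simp add: g_def K_def) (simp add: field_simps power2_eq_square)
    moreover have "2\<^sup>2 \<le> r\<^sup>2" using assms unfolding r_def by (intro power_mono) auto
    then have "0 \<le> r * (r\<^sup>2 - 1) * (r\<^sup>2 - 4)"
      by (intro mult_nonneg_nonneg) (auto simp: r_def)
    moreover have "\<not> j + 2 < N" "j + 2 < 2 * N" using 2 assms by auto
    ultimately show ?thesis by (simp only: coeff if_True if_False)
  next
    case 3
    define v where "v = 3 * N - 1 - (j + 2)"
    \<comment> \<open>0 and 1 are roots of \<open>K (v - 1)\<close>, and from 2 on all its factors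
      are nonnegative.\<close>
    have "v = 0 \<or> v = 1 \<or> v \<ge> 2" by auto
    then have "0 \<le> K (real v - 1)" by (auto simp: K_def)
    moreover have "3 * r - 2 - real (j + 2) = real v - 1"
      using 3 by (simp add: v_def r_def of_nat_diff)
    ultimately show ?thesis using 3 by (simp add: coeff)
  next
    case 4
    then show ?thesis by (simp add: coeff)
  qed
qed

section \<open>Strict concavity from the second derivative\<close>

text \<open>The mean value theorem on both sides of an intermediate point compares two slopes of a
  strictly decreasing f'. Negativity is asked only strictly between points of \<open>S\<close>,
  which leaves out the endpoint 0, where \<open>single_sign_change_nonneg\<close> says
  nothing.\<close>

lemma strictly_concave_on_deriv2:
  fixes f f' f'' :: "real \<Rightarrow> real"
  assumes "convex S"
    and f': "\<And>x. x \<in> S \<Longrightarrow> (f has_real_derivative f' x) (at x)"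
    and f'': "\<And>x. x \<in> S \<Longrightarrow> (f' has_real_derivative f'' x) (at x)"
    and neg: "\<And>x y z. x \<in> S \<Longrightarrow> z \<in> S \<Longrightarrow> x < y \<Longrightarrow> y < z \<Longrightarrow> f'' y < 0"
  shows "strictly_concave_on S f"
proof -
  have between: "y \<in> S" if "x \<in> S" "z \<in> S" "x \<le> y" "y \<le> z" for x y z
    using mem_is_interval_1_I[of S x z y] \<open>convex S\<close> that by (simp add: is_interval_convex_1)
  have decr: "f' z < f' x" if "x \<in> S" "z \<in> S" "x < z" for x z
  proof (rule DERIV_neg_imp_decreasing_open[OF \<open>x < z\<close>])
    show "\<exists>d. (f' has_real_derivative d) (at y) \<and> d < 0" if "x < y" "y < z" for y
    proof (intro exI conjI)
      show "(f' has_real_derivative f'' y) (at y)"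
        using between[of x z y] \<open>x \<in> S\<close> \<open>z \<in> S\<close> that by (intro f'') simp
      show "f'' y < 0" using neg \<open>x \<in> S\<close> \<open>z \<in> S\<close> that by blast
    qed
    show "continuous_on {x..z} f'"
      by (intro continuous_at_imp_continuous_on ballI, rule DERIV_isCont[OF f''])
        (use between[of x z] \<open>x \<in> S\<close> \<open>z \<in> S\<close> in auto)
  qed
  have main: "(1 - t) * f x + t * f y < f ((1 - t) * x + t * y)"
    if xy: "x \<in> S" "y \<in> S" "x < y" and t: "0 < t" "t < 1" for x y t
  proof -
    define z where "z = (1 - t) * x + t * y"
    have zx: "z - x = t * (y - x)" and yz: "y - z = (1 - t) * (y - x)"
      by (simp_all add: z_def algebra_simps)
    have "0 < z - x" "0 < y - z" unfolding zx yz using xy t by simp_all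
    then have z: "x < z" "z < y" by simp_all
    have deriv: "(f has_real_derivative f' w) (at w)" if "x \<le> w" "w \<le> y" for w
      by (rule f', rule between[OF xy(1,2) that])
    obtain p where p: "x < p" "p < z" "f z - f x = (z - x) * f' p"
      using MVT2[OF z(1), of f f'] deriv z(2) by auto
    obtain q where q: "z < q" "q < y" "f y - f z = (y - z) * f' q"
      using MVT2[OF z(2), of f f'] deriv z(1) by auto
    have "f' q < f' p"
      by (rule decr) (use p q z between[OF xy(1,2), of p] between[OF xy(1,2), of q] in auto)
    then have "0 < t * (1 - t) * (y - x) * (f' p - f' q)"
      using xy t by simp
    also have "\<dots> = (1 - t) * (f z - f x) - t * (f y - f z)"
      unfolding p(3) q(3) zx yz by (simp add: algebra_simps)
    finally show ?thesis unfolding z_def[symmetric] by (simp add: algebra_simps)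
  qed
  show ?thesis
    unfolding strictly_concave_on_def
  proof (intro conjI ballI allI impI)
    fix x y t
    assume *: "x \<in> S" "y \<in> S" "x \<noteq> y \<and> 0 < t \<and> t < (1::real)"
    show "(1 - t) * f x + t * f y < f ((1 - t) * x + t * y)"
    proof (cases "x < y")
      case True
      then show ?thesis using main * by blast
    next
      case False
      then show ?thesis using main[of y x "1 - t"] * by (simp add: algebra_simps)
    qed
  qed fact
qed

lemma strictly_concave_on_imp_concave_on:
  assumes "strictly_concave_on S f"
  shows "concave_on S f"
  unfolding concave_on_iff
proof (intro conjI ballI allI impI)
  show "convex S" using assms by (simp add: strictly_concave_on_def)
  fix x y u v :: real
  assume *: "x \<in> S" "y \<in> S" "0 \<le> u" "0 \<le> v" "u + v = 1"
  consider "x = y" | "v = 0" | "v = 1" | "x \<noteq> y" "0 < v" "v < 1" using * by linarith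
  then show "u * f x + v * f y \<le> f (u *\<^sub>R x + v *\<^sub>R y)"
  proof cases
    case 4
    have "(1 - v) * f x + v * f y < f ((1 - v) * x + v * y)"
      using assms *(1,2) 4 unfolding strictly_concave_on_def by blast
    moreover have "1 - v = u" using * by simp
    ultimately show ?thesis by simp
  qed (use * in \<open>auto simp: distrib_right[symmetric]\<close>)
qed

lemma strictly_concave_on_transfer:
  assumes "strictly_concave_on S g" "\<And>x. x \<in> S \<Longrightarrow> f x = g x"
  shows "strictly_concave_on S f"
  unfolding strictly_concave_on_def
proof (intro conjI ballI allI impI)
  show "convex S" using assms(1) by (simp add: strictly_concave_on_def)
  fix x y t :: real
  assume *: "x \<in> S" "y \<in> S" "x \<noteq> y \<and> 0 < t \<and> t < 1"
  then have "(1 - t) * x + t * y \<in> S"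
    using convexD_alt[OF \<open>convex S\<close> *(1,2), of t] by simp
  then show "(1 - t) * f x + t * f y < f ((1 - t) * x + t * y)"
    using assms * by (simp add: strictly_concave_on_def)
qed

section \<open>The benefit as a rational function without singularity at 1\<close>

definition benefit :: "real \<Rightarrow> real \<Rightarrow> nat \<Rightarrow> real \<Rightarrow> real" where
  "benefit C a N x = C * (a - (a + x * poly (pderiv (geo N)) x) / poly (geo N) x)"

text \<open>With S the sum of n + 1 powers, the throughput factor is (S - 1) / S and the mean queue
  length is x S' / S. The value at 1 comes from \<open>poly_geo_1\<close>.\<close>

lemma social_benefit_eq_benefit:
  assumes "C > 0" "x \<ge> 0"
  shows "social_benefit R C \<mu> n x = benefit C (R * \<mu> / C) (n + 1) x"
proof (cases "x = 1")
  case True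
  define a where "a = R * \<mu> / C"
  have "R * \<mu> = C * a" using assms(1) by (simp add: a_def)
  moreover have "poly (geo (n + 1)) 1 = real n + 1"
    "poly (pderiv (geo (n + 1))) 1 = (real n + 1) * real n / 2"
    using poly_geo_1(1,2)[of "n + 1"] by simp_all
  moreover have "C * a * (real n / (real n + 1)) - C * (real n / 2)
      = C * (a - (a + 1 * ((real n + 1) * real n / 2)) / (real n + 1))"
    by (simp add: field_simps)
  ultimately show ?thesis
    using True unfolding social_benefit_def benefit_def a_def[symmetric] by simp
next
  case False
  define s where "s = poly (geo (n + 1)) x"
  define s' where "s' = poly (pderiv (geo (n + 1))) x"
  have "s > 0" unfolding s_def using assms by (intro poly_geo_pos) auto
  have s: "1 - x ^ (n + 1) = (1 - x) * s"
    using arg_cong[OF one_minus_X_mult_geo[of "n + 1"], of "\<lambda>p. poly p x"]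
    by (simp add: s_def poly_monom algebra_simps)
  have "(1 - x) * s' = s - (real n + 1) * x ^ n" (is "?lhs = ?rhs")
    using arg_cong[OF one_minus_X_mult_geo'(1)[of "n + 1"], of "\<lambda>p. poly p x"]
    by (simp add: s_def s'_def poly_monom algebra_simps)
  then have "x * ?lhs = x * ?rhs" by (rule arg_cong)
  then have s': "(1 - x) * (x * s') = x * s - (real n + 1) * x ^ (n + 1)"
    by (simp add: algebra_simps)
  have "x * (1 - x ^ n) = (1 - x) * (s - 1)" using s by (simp add: algebra_simps)
  then have throughput: "x * (1 - x ^ n) / (1 - x ^ (n + 1)) = (s - 1) / s"
    unfolding s using False by simp
  have "x / (1 - x) - (real n + 1) * x ^ (n + 1) / (1 - x ^ (n + 1))
      = (x * s - (real n + 1) * x ^ (n + 1)) / ((1 - x) * s)"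
    unfolding s using False \<open>s > 0\<close> by (simp add: diff_divide_distrib)
  then have queue: "x / (1 - x) - (real n + 1) * x ^ (n + 1) / (1 - x ^ (n + 1)) = x * s' / s"
    unfolding s'[symmetric] using False by simp
  define a where "a = R * \<mu> / C"
  have a: "R * \<mu> = C * a" using assms(1) by (simp add: a_def)
  have "C * a * ((s - 1) / s) - C * (x * s' / s) = C * (a - (a + x * s') / s)"
    using \<open>s > 0\<close> by (simp add: field_simps)
  then show ?thesis
    using False
    unfolding social_benefit_def benefit_def throughput queue a_def[symmetric] a
      s_def[symmetric] s'_def[symmetric] by simp
qed

lemma benefit_deriv:
  assumes "N > 0" "x \<ge> 0"
  shows "(benefit C a N has_real_derivative
    C * poly (numer' a N) x / (poly (geo N) x)\<^sup>2) (at x)"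
proof -
  have "poly (geo N) x \<noteq> 0" using poly_geo_pos[OF assms] by simp
  then show ?thesis
    unfolding benefit_def[abs_def]
    by (auto intro!: derivative_eq_intros poly_DERIV
        simp: numer'_def field_simps power2_eq_square)
qed

lemma benefit_deriv2:
  assumes "N > 0" "x \<ge> 0"
  shows "((\<lambda>x. C * poly (numer' a N) x / (poly (geo N) x)\<^sup>2) has_real_derivative
    C * poly (numer'' a N) x / (poly (geo N) x) ^ 3) (at x)"
proof -
  have "poly (geo N) x \<noteq> 0" using poly_geo_pos[OF assms] by simp
  then show ?thesis
    by (auto intro!: derivative_eq_intros poly_DERIV
        simp: numer''_def field_simps power2_eq_square power3_eq_cube)
qed

text \<open>For \<open>N >= 3\<close> the index 2 N - 4 lies in the upper range and has coefficient
  -1. By the sign pattern no later coefficient is positive, so the leading one is negative.\<close>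

lemma numer'_eventually_neg:
  assumes "N \<ge> 3"
  obtains b where "b > 0" "poly (numer' a N) b < 0"
proof -
  let ?p = "- numer' a N"
  define i where "i = 2 * N - 4"
  have i: "Suc i = 2 * N - 3" "real (Suc i) = 2 * real N - 3"
    using assms by (auto simp: i_def of_nat_diff)
  have "coeff (numer' a N) i = -1"
    unfolding coeff_numer' i using assms by auto
  then have "coeff ?p i \<noteq> 0" by simp
  then have deg: "i \<le> degree ?p" by (rule le_degree)
  obtain k where k: "\<And>i. i < k \<Longrightarrow> coeff ?p i \<le> 0" "\<And>i. i \<ge> k \<Longrightarrow> coeff ?p i \<ge> 0"
    using single_sign_change_numer'[of N a] assms unfolding single_sign_change_def by auto
  have "k \<le> i" using k(1)[of i] \<open>coeff (numer' a N) i = -1\<close> by force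
  then have "lead_coeff ?p \<ge> 0" using k(2) deg by simp
  moreover have "?p \<noteq> 0" using \<open>coeff ?p i \<noteq> 0\<close> by auto
  ultimately have "lead_coeff ?p > 0" by (simp add: less_le)
  then obtain m where "\<And>x. x \<ge> m \<Longrightarrow> poly ?p x \<ge> lead_coeff ?p"
    using poly_pinfty_gt_lc by blast
  then have "poly ?p (max m 1) > 0" using \<open>lead_coeff ?p > 0\<close> by (meson less_le_trans max.cobounded1)
  then show ?thesis using that[of "max m 1"] by simp
qed

text \<open>The mode is a root of \<open>numer'\<close>, which exists because the value at 0 is
  \<open>a - 1 > 0\<close> and a negative value occurs later. Strict sign comparison fixes the sign
  on either side of it.\<close>

lemma unimodal_benefit:
  assumes "N \<ge> 3" "a > 1" "C > 0"
  shows "unimodal (benefit C a N)"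
proof -
  let ?p = "numer' a N"
  have p0: "coeff ?p 0 = a - 1" using assms by (simp add: coeff_numer')
  obtain b where "b > 0" "poly ?p b < 0" using numer'_eventually_neg assms(1) by blast
  then obtain c where c: "0 < c" "poly ?p c = 0"
    using poly_IVT_neg[of 0 b ?p] p0 assms(2) by (auto simp: poly_0_coeff_0)
  have strict: "poly ?p y < 0" if "0 < x" "x < y" "poly ?p x \<le> 0" for x y
    using single_sign_change_strict[of "- ?p" x y] single_sign_change_numer'[of N a] p0 assms that
    by simp
  have pos: "poly ?p x > 0" if "0 \<le> x" "x < c" for x
    using strict[of x c] c that p0 assms(2) by (cases "x = 0") (force simp: poly_0_coeff_0)+
  have neg: "poly ?p x < 0" if "c < x" for x
    using strict[of c x] c that by simp
  have sq: "(poly (geo N) x)\<^sup>2 > 0" if "x \<ge> 0" for x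
    using poly_geo_pos[of N x] assms that by simp
  have deriv: "(benefit C a N has_real_derivative
      C * poly ?p x / (poly (geo N) x)\<^sup>2) (at x)" if "x \<ge> 0" for x
    using benefit_deriv assms that by simp
  have cont: "continuous_on {x..y} (benefit C a N)" if "x \<ge> 0" for x y
    by (intro continuous_at_imp_continuous_on ballI, rule DERIV_isCont[OF deriv]) (use that in auto)
  have "strict_mono_on {0..c} (benefit C a N)"
  proof (rule strict_mono_onI)
    fix x y assume xy: "x \<in> {0..c}" "y \<in> {0..c}" "x < y"
    show "benefit C a N x < benefit C a N y"
    proof (rule DERIV_pos_imp_increasing_open[OF \<open>x < y\<close>])
      fix z assume z: "x < z" "z < y"
      then have "C * poly ?p z / (poly (geo N) z)\<^sup>2 > 0"
        using xy pos[of z] sq[of z] assms by (intro divide_pos_pos mult_pos_pos) auto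
      then show "\<exists>d. (benefit C a N has_real_derivative d) (at z) \<and> 0 < d"
        using deriv[of z] xy z by auto
    qed (use cont xy in auto)
  qed
  moreover have "strict_antimono_on {c..} (benefit C a N)"
  proof (rule monotone_onI)
    fix x y assume xy: "x \<in> {c..}" "y \<in> {c..}" "x < y"
    show "benefit C a N x > benefit C a N y"
    proof (rule DERIV_neg_imp_decreasing_open[OF \<open>x < y\<close>])
      fix z assume z: "x < z" "z < y"
      then have "C * poly ?p z / (poly (geo N) z)\<^sup>2 < 0"
        using xy neg[of z] sq[of z] assms c by (intro divide_neg_pos mult_pos_neg) auto
      then show "\<exists>d. (benefit C a N has_real_derivative d) (at z) \<and> d < 0"
        using deriv[of z] xy z c by auto
    qed (use cont xy c in auto)
  qed
  ultimately show ?thesis unfolding unimodal_def using c(1) by (meson less_imp_le)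
qed

lemma geo_2: "geo 2 = [:1, 1:]"
  by (simp add: geo_def numeral_2_eq_2 monom_Suc one_pCons)

text \<open>For n = 1 both numerators are constant, which is the concave and increasing
  alternative.\<close>

lemma numer_2: "numer' a 2 = [:a - 1:]" "numer'' a 2 = [:- 2 * (a - 1):]"
  by (simp_all add: numer''_def numer'_def geo_2 pderiv_pCons power2_eq_square numeral_poly one_pCons)

theorem lemma3p1:
  fixes R C \<mu> :: real and n :: nat
  assumes "R > 0" and "C > 0" and "\<mu> > 0"
    and "n \<ge> 1"
    and "R * \<mu> / C \<ge> real n + 1"
  shows "strictly_concave_on {0..1} (social_benefit R C \<mu> n)
    \<and> (concave_on {0..} (social_benefit R C \<mu> n)
          \<and> strict_mono_on {0..} (social_benefit R C \<mu> n)
        \<or> unimodal (social_benefit R C \<mu> n))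
    \<and> (\<exists>f''. second_derivative_on {0..} (social_benefit R C \<mu> n) f''
          \<and> sign_changes_at_most_once_on {0..} f'')"
proof -
  define a where "a = R * \<mu> / C"
  define N where "N = n + 1"
  let ?f = "social_benefit R C \<mu> n" and ?F = "benefit C a N"
  define f' where "f' x = C * poly (numer' a N) x / (poly (geo N) x)\<^sup>2" for x
  define f'' where "f'' x = C * poly (numer'' a N) x / (poly (geo N) x) ^ 3" for x
  have N: "N \<ge> 2" and a: "a \<ge> real N" using assms by (auto simp: N_def a_def)
  have "a > 1" using N a by linarith
  have eq: "?f x = ?F x" if "x \<ge> 0" for x
    unfolding a_def N_def using assms that by (intro social_benefit_eq_benefit)
  have F': "(?F has_real_derivative f' x) (at x)"
    and F'': "(f' has_real_derivative f'' x) (at x)" if "x \<ge> 0" for x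
    unfolding f'_def[abs_def] f''_def using benefit_deriv benefit_deriv2 N that by auto
  have geo_pos: "poly (geo N) x > 0" if "x \<ge> 0" for x
    using poly_geo_pos N that by simp
  have f''_pos_iff: "f'' x > 0 \<longleftrightarrow> poly (numer'' a N) x > 0"
    and f''_neg_iff: "f'' x < 0 \<longleftrightarrow> poly (numer'' a N) x < 0" if "x \<ge> 0" for x
    using geo_pos[OF that] \<open>C > 0\<close>
    by (auto simp: f''_def zero_less_divide_iff divide_less_0_iff zero_less_mult_iff mult_less_0_iff)
  note change = single_sign_change_numer''[OF N, of a]

  have concave: "strictly_concave_on S ?f"
    if "convex S" "S \<subseteq> {0..}"
      and neg: "\<And>x y z. x \<in> S \<Longrightarrow> z \<in> S \<Longrightarrow> x < y \<Longrightarrow> y < z \<Longrightarrow> poly (numer'' a N) y < 0" for S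
  proof -
    have "strictly_concave_on S ?F"
    proof (rule strictly_concave_on_deriv2[OF \<open>convex S\<close>])
      show "(?F has_real_derivative f' x) (at x)" "(f' has_real_derivative f'' x) (at x)"
        if "x \<in> S" for x using F' F'' that \<open>S \<subseteq> {0..}\<close> by auto
      show "f'' y < 0" if "x \<in> S" "z \<in> S" "x < y" "y < z" for x y z
        using that \<open>S \<subseteq> {0..}\<close> f''_neg_iff[of y] neg[of x z y]
        by force
    qed
    then show ?thesis
      by (rule strictly_concave_on_transfer) (use eq \<open>S \<subseteq> {0..}\<close> in auto)
  qed
  have "poly (numer'' a N) 1 < 0"
  proof -
    have "1 < (real N)\<^sup>2" using N by (intro one_less_power) auto
    \<comment> \<open>The hypothesis on the ratio enters through \<open>a >= N\<close>, which makes
      \<open>2 * a - N\<close> positive.\<close>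
    then have "0 < (real N)\<^sup>2 * ((real N)\<^sup>2 - 1) * (2 * a - real N)"
      using N a by (intro mult_pos_pos) auto
    then show ?thesis by (simp add: poly_numer''_1)
  qed
  \<comment> \<open>A nonnegative value in (0, 1] would force one at 1.\<close>
  then have "poly (numer'' a N) x < 0" if "0 < x" "x \<le> 1" for x
    using single_sign_change_nonneg[OF change that] by force
  then have 1: "strictly_concave_on {0..1} ?f"
    by (intro concave) auto

  have 2: "concave_on {0..} ?f \<and> strict_mono_on {0..} ?f \<or> unimodal ?f"
  proof (cases "n = 1")
    case True
    then have "N = 2" by (simp add: N_def)
    have "strictly_concave_on {0..} ?f"
      by (rule concave) (use \<open>a > 1\<close> in \<open>auto simp: \<open>N = 2\<close> numer_2\<close>)
    moreover have "strict_mono_on {0..} ?f"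
    proof (rule strict_mono_onI)
      fix x y :: real assume xy: "x \<in> {0..}" "y \<in> {0..}" "x < y"
      have "?F x < ?F y"
      proof (rule DERIV_pos_imp_increasing[OF \<open>x < y\<close>])
        fix z assume "x \<le> z" "z \<le> y"
        then have "z \<ge> 0" using xy by simp
        then have "f' z > 0"
          using geo_pos[of z] \<open>C > 0\<close> \<open>a > 1\<close> by (simp add: f'_def \<open>N = 2\<close> numer_2)
        then show "\<exists>d. (?F has_real_derivative d) (at z) \<and> 0 < d"
          using F' \<open>z \<ge> 0\<close> by blast
      qed
      then show "?f x < ?f y" using eq xy by simp
    qed
    ultimately show ?thesis using strictly_concave_on_imp_concave_on by blast
  next
    case False
    then have "unimodal ?F"
      using assms \<open>a > 1\<close> by (intro unimodal_benefit) (auto simp: N_def)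
    then obtain c where c: "c \<ge> 0" "strict_mono_on {0..c} ?F" "strict_antimono_on {c..} ?F"
      unfolding unimodal_def by blast
    then have "strict_mono_on {0..c} ?f" "strict_antimono_on {c..} ?f"
      using eq by (simp_all add: monotone_on_def)
    with c(1) show ?thesis unfolding unimodal_def by blast
  qed

  have "second_derivative_on {0..} ?f f''"
    unfolding second_derivative_on_def
  proof (intro exI[of _ f'] ballI conjI)
    fix x :: real assume x: "x \<in> {0..}"
    have "(?F has_real_derivative f' x) (at x within {0..})"
      using F' x by (simp add: has_field_derivative_at_within)
    \<comment> \<open>The two functions are known to agree only on the half-line, so the derivative
      is transferred relative to it; the radius 1 is arbitrary.\<close>
    then show "(?f has_real_derivative f' x) (at x within {0..})"
      by (rule has_field_derivative_transform_within[of _ _ _ _ 1]) (use x eq in auto)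
    show "(f' has_real_derivative f'' x) (at x within {0..})"
      using F'' x by (simp add: has_field_derivative_at_within)
  qed
  moreover have "sign_changes_at_most_once_on {0..} f''"
  proof -
    \<comment> \<open>Positivity persists to the right, while any alternating triple contains a
      positive value followed by a negative one.\<close>
    have up: "f'' y > 0" if "0 \<le> x" "x < y" "f'' x > 0" for x y
      using single_sign_change_pos[OF change, of x y] f''_pos_iff that by simp
    have False if "0 \<le> x" "x < y" "y < z" "f'' x * f'' y < 0" "f'' y * f'' z < 0" for x y z
      using up[of x y] up[of y z] that by (auto simp: mult_less_0_iff)
    then show ?thesis unfolding sign_changes_at_most_once_on_def by auto
  qed
  ultimately show ?thesis using 1 2 by blast
qed

end
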